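(* Let $m_{n,k}$ denote the maximum number of inversions achieved by a member of $\mathcal{R}_{n,k}$, where $k\geq 1$ and $n\geq 2k-1$. If $2k-1\leq n<\binom{k+1}{2}$, then $$m_{n,k}=k^2+(r^2-r+2d-2)k+3\binom{r+1}{4}-2\binom{r+1}{3}+(d-1)\binom{r}{2}-dr+\frac{d^2-5d+2}{2},$$ where $n=2k-1+\binom{r}{2}+d$ with $1\leq r\leq k-2$ and $0\leq d<r$. If $n\geq \binom{k+1}{2}$, then $$m_{n,k}=\frac{3k+3r+2}{4}\binom{k+r+1}{3}-\frac{3r-2}{4}\binom{r+1}{3}-\binom{k+r-d+1}{3}-\left(rk+\binom{k}{2}+d\right)\binom{r+1}{2}+(k+r)\binom{d}{2}-\binom{d}{3},$$ where $n=\binom{k+1}{2}+rk+d$ with $r\geq 0$ and $0\leq d<k$. Furthermore, the value $m_{n,k}$ is achieved by exactly $\binom{r}{d}$ members of $\mathcal{R}_{n,k}$ in the first case and exactly $\binom{k}{d}$ members of $\mathcal{R}_{n,k}$ in the second.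
   Context: Permutations $\pi=\pi_1\cdots\pi_n$ of $[n]=\{1,\ldots,n\}$ are written in one-line notation. An inversion of $\pi$ is a pair $(i,j)$ with $1\le i<j\le n$ and $\pi_i>\pi_j$. A run of $\pi$ is a maximal increasing sequence of consecutive entries. A permutation is run-sorted if $\pi_1=1$ and the first entries of its runs, read from left to right, form an increasing sequence. $\mathcal{R}_{n,k}$ denotes the set of run-sorted permutations of $[n]$ having exactly $k$ runs (it is nonempty for $n\ge 2k-1$). Binomial coefficients $\binom{a}{b}$ are $0$ unless $0\le b\le a$. *)

theory Defs
  imports Complex_Main "HOL-Combinatorics.Permutations"
begin

text \<open>A permutation of \<open>[n]\<close> is a function \<open>p\<close> with \<open>p permutes {1..n}\<close>;
  the \<open>i\<close>-th entry of its one-line notation is \<open>p i\<close>.\<close>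

definition inversions :: "nat \<Rightarrow> (nat \<Rightarrow> nat) \<Rightarrow> (nat \<times> nat) set" where
  "inversions n p = {(i, j). 1 \<le> i \<and> i < j \<and> j \<le> n \<and> p i > p j}"

definition inv_count :: "nat \<Rightarrow> (nat \<Rightarrow> nat) \<Rightarrow> nat" where
  "inv_count n p = card (inversions n p)"

definition increasing_block :: "nat \<Rightarrow> (nat \<Rightarrow> nat) \<Rightarrow> nat \<Rightarrow> nat \<Rightarrow> bool" where
  "increasing_block n p a b \<longleftrightarrow> 1 \<le> a \<and> a \<le> b \<and> b \<le> n \<and> strict_mono_on {a..b} p"

text \<open>A run is represented by the pair \<open>(a, b)\<close> of its first and last positions.\<close>

definition runs :: "nat \<Rightarrow> (nat \<Rightarrow> nat) \<Rightarrow> (nat \<times> nat) set" where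
  "runs n p = {(a, b). increasing_block n p a b \<and>
     (\<forall>a' b'. increasing_block n p a' b' \<and> {a..b} \<subseteq> {a'..b'} \<longrightarrow> a' = a \<and> b' = b)}"

definition run_sorted :: "nat \<Rightarrow> (nat \<Rightarrow> nat) \<Rightarrow> bool" where
  "run_sorted n p \<longleftrightarrow> p 1 = 1 \<and>
     (\<forall>(a, b) \<in> runs n p. \<forall>(a', b') \<in> runs n p. a < a' \<longrightarrow> p a < p a')"

definition run_sorted_perms :: "nat \<Rightarrow> nat \<Rightarrow> (nat \<Rightarrow> nat) set" where
  "run_sorted_perms n k = {p. p permutes {1..n} \<and> run_sorted n p \<and> card (runs n p) = k}"

definition max_inv :: "nat \<Rightarrow> nat \<Rightarrow> nat" where
  "max_inv n k = Max (inv_count n ` run_sorted_perms n k)"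

definition maximizers :: "nat \<Rightarrow> nat \<Rightarrow> (nat \<Rightarrow> nat) set" where
  "maximizers n k = {p \<in> run_sorted_perms n k. inv_count n p = max_inv n k}"

definition params_small :: "nat \<Rightarrow> nat \<Rightarrow> nat \<Rightarrow> nat \<Rightarrow> bool" where
  "params_small n k r d \<longleftrightarrow>
     n = 2 * k - 1 + (r choose 2) + d \<and> 1 \<le> r \<and> r + 2 \<le> k \<and> d < r"

definition params_large :: "nat \<Rightarrow> nat \<Rightarrow> nat \<Rightarrow> nat \<Rightarrow> bool" where
  "params_large n k r d \<longleftrightarrow> n = (k + 1 choose 2) + r * k + d \<and> d < k"

end

theory Submission
  imports Defs "HOL-Library.Infinite_Set"
begin

text \<open>The positions where the runs of a run-sorted permutation start already bound its
  inversions. The first entry of a run is smaller than everything in later runs, so only a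
  position behind the first of its run can be inverted with a position to its right, which
  must belong to a later run. These \<open>possible_inversions\<close> can all be realised at once, by a
  run-sorted permutation with the same run starts (\<open>attaining_permutation_exists\<close>); it is
  the only one, because a permutation is determined by its inversion set
  (\<open>permutes_eq_if_inversions_eq\<close>). Hence the maximisation, including the number of
  maximisers, takes place over the sets of run starts (\<open>max_inv_via_start_sets\<close>).

  Let the runs \<open>0, \<dots>, k - 1\<close> have \<open>e 0 + 1, \<dots>, e (k - 1) + 1\<close> entries. Run-sortedness forces
  \<open>e x \<ge> 1\<close> for all runs but the last, and the sum of all \<open>e x\<close> is \<open>n - k\<close>. The number of
  possible inversions is the sum of \<open>e x * (e y + 1)\<close> over \<open>x < y\<close>. Completing the square
  (\<open>possible_inversions_complete_square\<close>), twice this number is a constant minus the sum of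
  the squares of \<open>e x - (k - 1 - x)\<close>.

  It remains to minimise a sum of squares of integers with a given sum and lower bounds
  (\<open>bounded_least_squares\<close>). The differences \<open>e x - (k - 1 - x)\<close> have to be as equal as the
  lower bounds permit, so on the runs not held at their lower bound they take two
  consecutive values. If \<open>n \<ge> (k + 1 choose 2)\<close>, the lower bounds do not interfere: the
  differences are \<open>r\<close> and \<open>r + 1\<close>, the latter for an arbitrary choice of \<open>d\<close> of the \<open>k\<close> runs. If
  \<open>n\<close> is smaller, all but the first \<open>r\<close> runs are held at their lower bounds, and an arbitrary
  choice of \<open>d\<close> among these \<open>r\<close> runs receives one additional entry. This explains the numbers
  of maximisers; the values follow from the sums of the first integers and squares.\<close>

section \<open>Run-sorted permutations and their run starts\<close>

definition run_starts :: "nat \<Rightarrow> (nat \<Rightarrow> nat) \<Rightarrow> nat set" where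
  "run_starts n p = {i \<in> {1..n}. i = 1 \<or> p i < p (i - 1)}"

lemma ascent_if_not_run_start:
  assumes "p permutes {1..n}" "i \<in> {1..n}" "i \<notin> run_starts n p"
  shows "p (i - 1) < p i"
proof -
  have "p (i - 1) \<noteq> p i"
    using inj_eq[OF permutes_inj[OF assms(1)]] assms(2,3) unfolding run_starts_def by auto
  then show ?thesis using assms unfolding run_starts_def by auto
qed

lemma less_within_run:
  assumes p: "p permutes {1..n}" and "i < j" "1 \<le> i" "j \<le> n"
    and "{i<..j} \<inter> run_starts n p = {}"
  shows "p i < p j"
  using \<open>i < j\<close> assms(3-5)
proof (induction rule: strict_inc_induct)
  case (base i)
  then show ?case using ascent_if_not_run_start[OF p, of "Suc i"] by force
next
  case (step i)
  have "p i < p (Suc i)"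
    using step ascent_if_not_run_start[OF p, of "Suc i"] by force
  also have "p (Suc i) < p j"
  proof (rule step.IH)
    have "{Suc i<..j} \<subseteq> {i<..j}" by auto
    then show "{Suc i<..j} \<inter> run_starts n p = {}" using step.prems by blast
  qed (use step.prems in auto)
  finally show ?case .
qed

lemma increasing_block_iff:
  assumes p: "p permutes {1..n}"
  shows "increasing_block n p a b \<longleftrightarrow>
    1 \<le> a \<and> a \<le> b \<and> b \<le> n \<and> {a<..b} \<inter> run_starts n p = {}"
proof
  assume *: "increasing_block n p a b"
  then have ab: "1 \<le> a" "a \<le> b" "b \<le> n" and mono: "strict_mono_on {a..b} p"
    unfolding increasing_block_def by auto
  have "i \<notin> run_starts n p" if i: "i \<in> {a<..b}" for i
  proof -
    have "p (i - 1) < p i" using i by (intro strict_mono_onD[OF mono]) auto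
    then show ?thesis using i ab unfolding run_starts_def by auto
  qed
  then show "1 \<le> a \<and> a \<le> b \<and> b \<le> n \<and> {a<..b} \<inter> run_starts n p = {}"
    using ab by blast
next
  assume *: "1 \<le> a \<and> a \<le> b \<and> b \<le> n \<and> {a<..b} \<inter> run_starts n p = {}"
  have "p i < p j" if "i \<in> {a..b}" "j \<in> {a..b}" "i < j" for i j
  proof (rule less_within_run[OF p])
    have "{i<..j} \<subseteq> {a<..b}" using that by auto
    then show "{i<..j} \<inter> run_starts n p = {}" using * by blast
  next
    show "i < j" by (rule that)
    show "1 \<le> i" "j \<le> n" using * that by auto
  qed
  then have "strict_mono_on {a..b} p" by (intro strict_mono_onI)
  with * show "increasing_block n p a b" unfolding increasing_block_def by blast
qed

lemma fst_runs:
  assumes p: "p permutes {1..n}"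
  shows "fst ` runs n p = run_starts n p"
proof
  show "fst ` runs n p \<subseteq> run_starts n p"
  proof
    fix a assume "a \<in> fst ` runs n p"
    then obtain b where b: "(a, b) \<in> runs n p" by auto
    show "a \<in> run_starts n p"
    proof (rule ccontr)
      assume a: "a \<notin> run_starts n p"
      have ab: "increasing_block n p a b" using b unfolding runs_def by auto
      have a1: "a > 1" using a ab unfolding run_starts_def increasing_block_def
        by (cases "a = 1") auto
      have "{a - 1<..b} \<subseteq> insert a {a<..b}" by auto
      then have "increasing_block n p (a - 1) b"
        using a1 ab a unfolding increasing_block_iff[OF p] by auto
      moreover have "{a..b} \<subseteq> {a - 1..b}" by auto
      ultimately have "a - 1 = a" using b unfolding runs_def by blast
      with a1 show False by simp
    qed
  qed
next
  show "run_starts n p \<subseteq> fst ` runs n p"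
  proof
    fix a assume a: "a \<in> run_starts n p"
    define B where "B = {b. increasing_block n p a b}"
    have fin: "finite B"
      by (rule finite_subset[of _ "{..n}"]) (auto simp: B_def increasing_block_def)
    have ne: "a \<in> B" using a unfolding B_def increasing_block_iff[OF p] by (auto simp: run_starts_def)
    have mx: "Max B \<in> B" using fin ne by (intro Max_in) auto
    have "(a, Max B) \<in> runs n p"
    proof -
      have inc: "increasing_block n p a (Max B)" using mx unfolding B_def by simp
      have "\<forall>a' b'. increasing_block n p a' b' \<and> {a..Max B} \<subseteq> {a'..b'} \<longrightarrow>
        a' = a \<and> b' = Max B"
      proof (intro allI impI)
        fix a' b' assume *: "increasing_block n p a' b' \<and> {a..Max B} \<subseteq> {a'..b'}"
        have "a \<le> Max B" using inc unfolding increasing_block_def by simp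
        then have le: "a' \<le> a" "Max B \<le> b'" using * by (auto simp: atLeastatMost_subset_iff)
        have "a' = a"
        proof (rule ccontr)
          assume "a' \<noteq> a"
          then have "a \<in> {a'<..b'}" using le \<open>a \<le> Max B\<close> by auto
          then show False using * a unfolding increasing_block_iff[OF p] by blast
        qed
        moreover from this have "b' \<in> B" using * unfolding B_def by simp
        then have "b' \<le> Max B" using fin by simp
        ultimately show "a' = a \<and> b' = Max B" using le by simp
      qed
      with inc show ?thesis unfolding runs_def mem_Collect_eq prod.case by (rule conjI)
    qed
    then show "a \<in> fst ` runs n p" by force
  qed
qed

lemma inj_on_fst_runs: "inj_on fst (runs n p)"
proof -
  have *: "b' = b" if "(a, b) \<in> runs n p" "(a, b') \<in> runs n p" "b \<le> b'" for a b b'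
  proof -
    have "increasing_block n p a b'" using that(2) unfolding runs_def by simp
    moreover have "{a..b} \<subseteq> {a..b'}" using that(3) by simp
    ultimately show ?thesis using that(1) unfolding runs_def mem_Collect_eq prod.case by metis
  qed
  show ?thesis
  proof (rule inj_onI)
    fix x y assume xy: "x \<in> runs n p" "y \<in> runs n p" "fst x = fst y"
    obtain a b where x: "x = (a, b)" by (cases x)
    obtain b' where y: "y = (a, b')" using xy(3) x by (cases y) auto
    show "x = y"
    proof (cases "b \<le> b'")
      case True
      then show ?thesis using *[of a b b'] xy x y by simp
    next
      case False
      then show ?thesis using *[of a b' b] xy x y by simp
    qed
  qed
qed

lemma card_runs:
  assumes "p permutes {1..n}"
  shows "card (runs n p) = card (run_starts n p)"
  using card_image[OF inj_on_fst_runs[of n p]] unfolding fst_runs[OF assms] by simp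

text \<open>A run is determined by its first position, so both the number of runs and the
  run-sorted condition can be read off from the set of run starts alone.\<close>

lemma run_sorted_iff:
  assumes "p permutes {1..n}"
  shows "run_sorted n p \<longleftrightarrow> p 1 = 1 \<and> strict_mono_on (run_starts n p) p"
proof -
  have "(\<forall>(a, b) \<in> runs n p. \<forall>(a', b') \<in> runs n p. a < a' \<longrightarrow> p a < p a') \<longleftrightarrow>
    (\<forall>a \<in> fst ` runs n p. \<forall>a' \<in> fst ` runs n p. a < a' \<longrightarrow> p a < p a')"
    by (simp add: case_prod_beta)
  then show ?thesis unfolding run_sorted_def fst_runs[OF assms] strict_mono_on_def
    by (simp only:) blast
qed

text \<open>The sets that occur as run starts of run-sorted permutations. Two consecutive
  starts would be a descent between the first entries of two neighbouring runs; hence only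
  the last run may have length one.\<close>

definition start_sets :: "nat \<Rightarrow> nat \<Rightarrow> nat set set" where
  "start_sets n k = {S. S \<subseteq> {1..n} \<and> 1 \<in> S \<and> card S = k \<and> (\<forall>i\<in>S. Suc i \<notin> S)}"

lemma run_starts_in_start_sets:
  assumes "p \<in> run_sorted_perms n k" "n \<ge> 1"
  shows "run_starts n p \<in> start_sets n k"
proof -
  have p: "p permutes {1..n}" and "run_sorted n p" and k: "card (run_starts n p) = k"
    using assms card_runs unfolding run_sorted_perms_def by auto
  then have mono: "strict_mono_on (run_starts n p) p" using run_sorted_iff by blast
  have "Suc i \<notin> run_starts n p" if i: "i \<in> run_starts n p" for i
  proof
    assume j: "Suc i \<in> run_starts n p"
    have "p i < p (Suc i)" using strict_mono_onD[OF mono i j] by simp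
    then show False using i j unfolding run_starts_def by auto
  qed
  then show ?thesis using k assms(2) unfolding start_sets_def run_starts_def by auto
qed

section \<open>The largest inversion set with given run starts\<close>

text \<open>The pairs whose first component is not the first position of its run and whose second
  component lies in a later run.\<close>

definition possible_inversions :: "nat \<Rightarrow> nat set \<Rightarrow> (nat \<times> nat) set" where
  "possible_inversions n S =
     {(i, j). 1 \<le> i \<and> i < j \<and> j \<le> n \<and> i \<notin> S \<and> (\<exists>s\<in>S. i < s \<and> s \<le> j)}"

lemma finite_possible_inversions: "finite (possible_inversions n S)"
  by (rule finite_subset[of _ "{1..n} \<times> {1..n}"]) (auto simp: possible_inversions_def)

text \<open>The first entry of a run is smaller than the first entry of every later run, and so
  smaller than every entry there; and two entries of one run are never inverted.\<close>

lemma inversions_subset: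
  assumes "p \<in> run_sorted_perms n k"
  shows "inversions n p \<subseteq> possible_inversions n (run_starts n p)"
proof (clarify)
  let ?S = "run_starts n p"
  fix i j assume ij: "(i, j) \<in> inversions n p"
  have p: "p permutes {1..n}" and mono: "strict_mono_on ?S p"
    using assms run_sorted_iff unfolding run_sorted_perms_def by auto
  have *: "1 \<le> i" "i < j" "j \<le> n" "p j < p i" using ij unfolding inversions_def by auto
  \<comment> \<open>Positions of the same run carry increasing entries.\<close>
  have "{i<..j} \<inter> ?S \<noteq> {}"
    using less_within_run[OF p *(2,1,3)] *(4) by fastforce
  then have ex: "\<exists>s\<in>?S. i < s \<and> s \<le> j" by auto
  have "i \<notin> ?S"
  proof
    assume i: "i \<in> ?S"
    \<comment> \<open>The start of the run that contains position \<open>j\<close>.\<close>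
    define s where "s = Max (?S \<inter> {..j})"
    have s: "s \<in> ?S \<inter> {..j}" unfolding s_def using i * by (intro Max_in) auto
    have smax: "t \<le> s" if "t \<in> ?S \<inter> {..j}" for t unfolding s_def using that by simp
    have "i \<le> s" using smax[of i] i * by auto
    then have "p i \<le> p s"
      using strict_mono_onD[OF mono i, of s] s by (cases "i = s") auto
    moreover have "p s \<le> p j"
    proof (cases "s = j")
      case False
      have "{s<..j} \<inter> ?S = {}" using smax by fastforce
      then show ?thesis using less_within_run[OF p, of s j] s False *(3) by (auto simp: run_starts_def)
    qed simp
    ultimately show False using * by simp
  qed
  then show "(i, j) \<in> possible_inversions n ?S"
    using * ex unfolding possible_inversions_def by auto
qed

text \<open>An entry is determined by the number of smaller entries, and the inversion set tells
  of any two positions which one carries the smaller entry.\<close>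

lemma permutes_eq_if_inversions_eq:
  assumes p: "p permutes {1..n}" and q: "q permutes {1..n}"
    and inv: "inversions n p = inversions n q"
  shows "p = q"
proof
  fix i
  show "p i = q i"
  proof (cases "i \<in> {1..n}")
    case False
    then show ?thesis using permutes_not_in[OF p] permutes_not_in[OF q] by simp
  next
    case True
    have rank: "card {j \<in> {1..n}. f j < f i} = f i - 1" if f: "f permutes {1..n}" for f
    proof -
      have "f ` {j \<in> {1..n}. f j < f i} = {1..<f i}"
      proof
        show "{1..<f i} \<subseteq> f ` {j \<in> {1..n}. f j < f i}"
        proof
          fix y assume y: "y \<in> {1..<f i}"
          have "f i \<in> {1..n}" using True permutes_in_image[OF f] by blast
          then have "y \<in> f ` {1..n}" using y permutes_image[OF f] by auto
          then show "y \<in> f ` {j \<in> {1..n}. f j < f i}" using y by auto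
        qed
        show "f ` {j \<in> {1..n}. f j < f i} \<subseteq> {1..<f i}"
        proof clarify
          fix j assume "j \<in> {1..n}" "f j < f i"
          then show "f j \<in> {1..<f i}" using permutes_in_image[OF f, of j] by auto
        qed
      qed
      then have "card {1..<f i} = card {j \<in> {1..n}. f j < f i}"
        using card_image[OF inj_on_subset[OF permutes_inj[OF f] subset_UNIV]] by metis
      then show ?thesis by simp
    qed
    have below: "f j < f i \<longleftrightarrow> (if j < i then (j, i) \<notin> inversions n f else (i, j) \<in> inversions n f)"
      if f: "f permutes {1..n}" and j: "j \<in> {1..n}" for f j
    proof -
      have "f j = f i \<longleftrightarrow> j = i" using inj_eq[OF permutes_inj[OF f]] by simp
      then show ?thesis using True j unfolding inversions_def by auto
    qed
    have "{j \<in> {1..n}. p j < p i} = {j \<in> {1..n}. q j < q i}"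
      using below[OF p] below[OF q] inv by auto
    then have "p i - 1 = q i - 1" using rank[OF p] rank[OF q] by simp
    moreover have "p i \<ge> 1" "q i \<ge> 1"
      using True permutes_in_image[OF p, of i] permutes_in_image[OF q, of i] by auto
    ultimately show ?thesis by simp
  qed
qed

text \<open>Replace each key by its rank among all keys.\<close>

lemma permutation_with_order_of_key:
  fixes key :: "nat \<Rightarrow> nat"
  assumes inj: "inj_on key {1..n}"
  obtains p where "p permutes {1..n}"
    "\<And>i j. i \<in> {1..n} \<Longrightarrow> j \<in> {1..n} \<Longrightarrow> p i < p j \<longleftrightarrow> key i < key j"
proof -
  define p where "p i = (if i \<in> {1..n} then card {j \<in> {1..n}. key j \<le> key i} else i)" for i
  have mono: "p i < p j" if "i \<in> {1..n}" "j \<in> {1..n}" "key i < key j" for i j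
  proof -
    have "{l \<in> {1..n}. key l \<le> key i} \<subset> {l \<in> {1..n}. key l \<le> key j}"
    proof (intro psubsetI)
      have "j \<in> {l \<in> {1..n}. key l \<le> key j} - {l \<in> {1..n}. key l \<le> key i}"
        using that by auto
      then show "{l \<in> {1..n}. key l \<le> key i} \<noteq> {l \<in> {1..n}. key l \<le> key j}"
        by blast
    qed (use that in auto)
    then have "card {l \<in> {1..n}. key l \<le> key i} < card {l \<in> {1..n}. key l \<le> key j}"
      by (intro psubset_card_mono) auto
    then show ?thesis using that unfolding p_def by auto
  qed
  have iff: "p i < p j \<longleftrightarrow> key i < key j" if ij: "i \<in> {1..n}" "j \<in> {1..n}" for i j
  proof -
    consider "key i < key j" | "key j < key i" | "i = j"
      using inj_onD[OF inj _ ij] by (meson linorder_neqE_nat)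
    then show ?thesis using mono[OF ij] mono[OF ij(2,1)] by cases auto
  qed
  have "inj_on p {1..n}"
  proof (rule inj_onI)
    fix i j assume ij: "i \<in> {1..n}" "j \<in> {1..n}" and "p i = p j"
    then have "key i = key j" using iff[OF ij] iff[OF ij(2,1)] by simp
    then show "i = j" using inj_onD[OF inj _ ij] by simp
  qed
  moreover have "p i \<in> {1..n}" if "i \<in> {1..n}" for i
  proof -
    have "card {j \<in> {1..n}. key j \<le> key i} \<le> card {1..n}" by (intro card_mono) auto
    moreover have "card {j \<in> {1..n}. key j \<le> key i} > 0" using that by (auto simp: card_gt_0_iff)
    ultimately show ?thesis using that unfolding p_def by auto
  qed
  ultimately have "bij_betw p {1..n} {1..n}"
    by (intro bij_betw_imageI endo_inj_surj) auto
  then have "p permutes {1..n}"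
    by (rule bij_imp_permutes) (simp only: p_def if_False)
  then show thesis using iff by (intro that)
qed

text \<open>The upper bound on the inversion set is attained by putting the values \<open>1, \<dots>, k\<close> on the
  run starts in increasing order, and then filling the remaining positions of the last run,
  of the last but one, and so on, with increasing values inside each run. This order is
  described by a key: a run start is its own key; any other position has a key that exceeds
  \<open>n\<close>, is larger the further left its run begins, and increases within the run.\<close>

lemma attaining_permutation_exists:
  assumes S: "S \<in> start_sets n k"
  obtains p where "p \<in> run_sorted_perms n k" "run_starts n p = S"
    "inversions n p = possible_inversions n S"
proof -
  have Sn: "S \<subseteq> {1..n}" and S1: "1 \<in> S" and Sk: "card S = k"
    and sep: "\<And>i. i \<in> S \<Longrightarrow> Suc i \<notin> S"
    using S unfolding start_sets_def by auto
  have n1: "n \<ge> 1" using S1 Sn by auto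
  \<comment> \<open>The start of the run that contains position \<open>i\<close>.\<close>
  define g where "g i = Max (S \<inter> {..i})" for i
  have g: "g i \<in> S \<inter> {..i}" if "1 \<le> i" for i
    unfolding g_def using that S1 by (intro Max_in) auto
  have g_ge: "s \<le> g i" if "s \<in> S" "s \<le> i" for s i
    unfolding g_def using that by simp
  have g_mono: "g i \<le> g j" if "1 \<le> i" "i \<le> j" for i j
    using g[OF that(1)] that by (intro g_ge) auto
  have g_less: "g i < g j \<longleftrightarrow> (\<exists>s\<in>S. i < s \<and> s \<le> j)" if "1 \<le> i" "i < j" for i j
  proof
    assume lt: "g i < g j"
    have gj: "g j \<in> S" "g j \<le> j" using g[of j] that by auto
    then have "i < g j" using g_ge[of "g j" i] lt by linarith
    then show "\<exists>s\<in>S. i < s \<and> s \<le> j" using gj by auto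
  next
    assume "\<exists>s\<in>S. i < s \<and> s \<le> j"
    then obtain s where "s \<in> S" "i < s" "s \<le> j" by auto
    then show "g i < g j" using g_ge[of s j] g[OF that(1)] by auto
  qed
  have g_le_n: "g i \<le> n" if "1 \<le> i" for i using g[OF that] Sn by auto
  define key where "key i = (if i \<in> S then i else (n + 1) * (n + 1 - g i) + i)" for i
  have key_gt: "n < key i" if "i \<in> {1..n}" "i \<notin> S" for i
  proof -
    have "(n + 1) * 1 \<le> (n + 1) * (n + 1 - g i)"
      using g_le_n[of i] that by (intro mult_le_mono2) auto
    then show ?thesis using that unfolding key_def by simp
  qed
  have key_less: "key j < key i \<longleftrightarrow> (i, j) \<in> possible_inversions n S"
    and key_neq: "key j \<noteq> key i" if ij: "i \<in> {1..n}" "j \<in> {1..n}" "i < j" for i j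
  proof -
    have eq: "(i, j) \<in> possible_inversions n S \<longleftrightarrow> i \<notin> S \<and> g i < g j"
      using ij g_less[of i j] unfolding possible_inversions_def by auto
    have "(key j < key i \<longleftrightarrow> i \<notin> S \<and> g i < g j) \<and> key j \<noteq> key i"
    proof (cases "i \<in> S")
      case True
      have "key i < key j"
        using True ij key_gt[of j] by (cases "j \<in> S") (auto simp: key_def)
      then show ?thesis using True by simp
    next
      case i: False
      show ?thesis
      proof (cases "j \<in> S")
        case True
        have "key j < key i" using True i ij key_gt[of i] by (auto simp: key_def)
        moreover have "g i < g j" using g_less[of i j] True ij by auto
        ultimately show ?thesis using i by simp
      next
        case j: False
        show ?thesis
        proof (cases "g i < g j")
          case True
          have "(n + 1) * (n + 1 - g j) + (n + 1) = (n + 1) * (n + 1 - g j + 1)"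
            by (simp add: algebra_simps)
          also have "\<dots> \<le> (n + 1) * (n + 1 - g i)"
            using True g_le_n[of j] ij by (intro mult_le_mono2) auto
          finally have "key j < key i" using i j ij unfolding key_def by simp
          then show ?thesis using True i by simp
        next
          case False
          then have "g i = g j" using g_mono[of i j] ij by auto
          then show ?thesis using i j ij unfolding key_def by simp
        qed
      qed
    qed
    then show "key j < key i \<longleftrightarrow> (i, j) \<in> possible_inversions n S" "key j \<noteq> key i"
      using eq by auto
  qed
  have "inj_on key {1..n}"
  proof (rule inj_onI, rule ccontr)
    fix i j assume "i \<in> {1..n}" "j \<in> {1..n}" "key i = key j" "i \<noteq> j"
    then show False using key_neq[of i j] key_neq[of j i] by (cases "i < j") auto
  qed
  then obtain p where p: "p permutes {1..n}"
    and order: "\<And>i j. i \<in> {1..n} \<Longrightarrow> j \<in> {1..n} \<Longrightarrow> p i < p j \<longleftrightarrow> key i < key j"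
    using permutation_with_order_of_key by blast
  have inv: "inversions n p = possible_inversions n S"
  proof -
    have "(i, j) \<in> inversions n p \<longleftrightarrow> (i, j) \<in> possible_inversions n S" for i j
    proof (cases "1 \<le> i \<and> i < j \<and> j \<le> n")
      case True
      then show ?thesis using order[of j i] key_less[of i j] unfolding inversions_def by auto
    next
      case False
      then show ?thesis unfolding inversions_def possible_inversions_def by auto
    qed
    then show ?thesis by auto
  qed
  have starts: "run_starts n p = S"
  proof -
    have "i \<in> run_starts n p \<longleftrightarrow> i \<in> S" if i: "i \<in> {1..n}" "i \<noteq> 1" for i
    proof -
      have "i \<in> run_starts n p \<longleftrightarrow> (i - 1, i) \<in> inversions n p"
        using i unfolding run_starts_def inversions_def by auto
      also have "\<dots> \<longleftrightarrow> i - 1 \<notin> S \<and> i \<in> S"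
      proof -
        obtain m where m: "i = Suc m" "1 \<le> m" using i by (cases i) auto
        have "m < s \<and> s \<le> Suc m \<longleftrightarrow> s = Suc m" for s by linarith
        then show ?thesis using i m unfolding inv possible_inversions_def by simp
      qed
      also have "\<dots> \<longleftrightarrow> i \<in> S" using sep[of "i - 1"] i by auto
      finally show ?thesis .
    qed
    moreover have "1 \<in> run_starts n p" using n1 unfolding run_starts_def by simp
    moreover have "run_starts n p \<subseteq> {1..n}" unfolding run_starts_def by auto
    ultimately show ?thesis using Sn S1 by (intro set_eqI) (metis subsetD)
  qed
  have "strict_mono_on S p"
    using Sn order by (auto intro!: strict_mono_onI simp: key_def subset_iff)
  moreover have "p 1 = 1"
  proof -
    have "1 \<in> p ` {1..n}" using permutes_image[OF p] n1 by simp
    then obtain i where i: "i \<in> {1..n}" "p i = 1" by auto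
    have "i = 1"
    proof (rule ccontr)
      assume "i \<noteq> 1"
      then have "key 1 < key i"
        using i key_gt[of i] S1 n1 by (cases "i \<in> S") (auto simp: key_def)
      then have "p 1 < p i" using order[of 1 i] i n1 by simp
      moreover have "p 1 \<in> {1..n}" using permutes_in_image[OF p] n1 by simp
      ultimately show False using i by simp
    qed
    then show ?thesis using i by simp
  qed
  ultimately have "p \<in> run_sorted_perms n k"
    using p starts Sk run_sorted_iff[OF p] card_runs[OF p] unfolding run_sorted_perms_def by simp
  then show thesis using starts inv by (intro that)
qed

section \<open>Counting the possible inversions by run lengths\<close>

text \<open>The start of run \<open>x\<close>, counted from \<open>0\<close>, if every run \<open>y\<close> has \<open>e y + 1\<close> entries.\<close>

definition start_sequence :: "(nat \<Rightarrow> nat) \<Rightarrow> nat \<Rightarrow> nat" where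
  "start_sequence e x = Suc (\<Sum>y<x. Suc (e y))"

text \<open>The entry \<open>e x\<close> is the length of run \<open>x\<close> minus one. Values at \<open>x \<ge> k\<close> are fixed to be
  zero, so that each choice of the \<open>k\<close> run lengths is represented by one function.\<close>

definition run_excesses :: "nat \<Rightarrow> nat \<Rightarrow> (nat \<Rightarrow> nat) set" where
  "run_excesses n k = {e. (\<forall>x\<ge>k. e x = 0) \<and> (\<forall>x. Suc x < k \<longrightarrow> 1 \<le> e x) \<and> (\<Sum>x<k. e x) + k = n}"

lemma start_sequence_simps:
  "start_sequence e 0 = 1"
  "start_sequence e (Suc x) = start_sequence e x + Suc (e x)"
  by (simp_all add: start_sequence_def)

lemma strict_mono_start_sequence: "strict_mono (start_sequence e)"
  by (simp add: strict_mono_Suc_iff start_sequence_simps)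

lemma start_sequence_end:
  assumes "e \<in> run_excesses n k"
  shows "start_sequence e k = Suc n"
  using assms by (simp add: start_sequence_def run_excesses_def sum.distrib sum_Suc)

lemma start_sequence_in_start_sets:
  assumes e: "e \<in> run_excesses n k" and "1 \<le> k"
  shows "start_sequence e ` {..<k} \<in> start_sets n k"
proof -
  let ?s = "start_sequence e"
  note mono = strict_mono_less[OF strict_mono_start_sequence[of e]]
    strict_mono_less_eq[OF strict_mono_start_sequence[of e]]
  have "?s x \<in> {1..n}" if "x < k" for x
    using mono(1)[of x k] that start_sequence_end[OF e] by (simp add: start_sequence_def)
  moreover have "1 \<in> ?s ` {..<k}"
    using \<open>1 \<le> k\<close> start_sequence_simps(1)[of e] by (intro image_eqI[of _ _ 0]) auto
  moreover have "card (?s ` {..<k}) = k"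
    using card_image[OF inj_on_subset[OF strict_mono_imp_inj_on[OF strict_mono_start_sequence[of e]] subset_UNIV]]
    by simp
  moreover have "Suc (?s x) \<noteq> ?s y" if "x < k" "y < k" for x y
  proof
    assume eq: "Suc (?s x) = ?s y"
    then have "x < y" using mono(1)[of x y] by simp
    then have "1 \<le> e x" using e that unfolding run_excesses_def by auto
    moreover have "?s (Suc x) \<le> ?s y" using \<open>x < y\<close> mono(2) by simp
    ultimately show False using eq by (simp add: start_sequence_simps)
  qed
  ultimately show ?thesis unfolding start_sets_def by auto
qed

lemma strict_mono_enumeration_unique:
  fixes f g :: "nat \<Rightarrow> 'a::linorder"
  assumes f: "strict_mono f" and g: "strict_mono g" and eq: "f ` {..<k} = g ` {..<k}"
    and "x < k"
  shows "f x = g x"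
  using \<open>x < k\<close>
proof (induction x rule: less_induct)
  case (less x)
  have *: "b x \<le> a x" if a: "strict_mono a" and b: "strict_mono b" and "a ` {..<k} = b ` {..<k}"
    and IH: "\<And>y. y < x \<Longrightarrow> a y = b y" for a b :: "nat \<Rightarrow> 'a"
  proof -
    have "a x \<in> b ` {..<k}" using that(3) less.prems by blast
    then obtain y where y: "a x = b y" by auto
    have "\<not> y < x" using IH[of y] y strict_mono_eq[OF a, of x y] by auto
    then show ?thesis using y strict_mono_less_eq[OF b, of x y] by simp
  qed
  show ?case
    using *[OF f g eq] *[OF g f eq[symmetric]] less.IH less.prems
    by (intro antisym) auto
qed

lemma bij_betw_run_excesses_start_sets:
  assumes "1 \<le> k"
  shows "bij_betw (\<lambda>e. start_sequence e ` {..<k}) (run_excesses n k) (start_sets n k)"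
proof (rule bij_betw_imageI)
  show "inj_on (\<lambda>e. start_sequence e ` {..<k}) (run_excesses n k)"
  proof (rule inj_onI)
    fix e e' assume e: "e \<in> run_excesses n k" and e': "e' \<in> run_excesses n k"
      and eq: "start_sequence e ` {..<k} = start_sequence e' ` {..<k}"
    have s: "start_sequence e x = start_sequence e' x" if "x \<le> k" for x
    proof (cases "x = k")
      case True
      then show ?thesis using start_sequence_end[OF e] start_sequence_end[OF e'] by simp
    next
      case False
      then show ?thesis using that
        by (intro strict_mono_enumeration_unique[OF strict_mono_start_sequence
              strict_mono_start_sequence eq]) simp
    qed
    show "e = e'"
    proof
      fix x show "e x = e' x"
      proof (cases "x < k")
        case True
        then show ?thesis using s[of x] s[of "Suc x"] by (simp add: start_sequence_simps)
      next
        case False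
        then show ?thesis using e e' unfolding run_excesses_def by simp
      qed
    qed
  qed
  show "(\<lambda>e. start_sequence e ` {..<k}) ` run_excesses n k = start_sets n k"
  proof
    show "(\<lambda>e. start_sequence e ` {..<k}) ` run_excesses n k \<subseteq> start_sets n k"
      using start_sequence_in_start_sets assms by blast
    show "start_sets n k \<subseteq> (\<lambda>e. start_sequence e ` {..<k}) ` run_excesses n k"
    proof
      fix S assume S: "S \<in> start_sets n k"
      then have Sn: "S \<subseteq> {1..n}" "1 \<in> S" "card S = k" and sep: "\<And>i. i \<in> S \<Longrightarrow> Suc i \<notin> S"
        unfolding start_sets_def by auto
      have fin: "finite S" using Sn(1) finite_subset by blast
      \<comment> \<open>The value at \<open>k\<close> is a sentinel: the position where a further run would start.\<close>
      define r where "r x = (if x < k then enumerate S x else Suc n)" for x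
      have r_in: "r x \<in> S" if "x < k" for x
        using that Sn(3) fin unfolding r_def by (simp add: finite_enumerate_in_set)
      have r_less: "r x < r (Suc x)" if "x < k" for x
      proof (cases "Suc x < k")
        case True
        then show ?thesis using fin Sn(3) unfolding r_def by (simp add: finite_enumerate_step)
      next
        case False
        then have "r (Suc x) = Suc n" by (simp add: r_def)
        moreover have "r x \<in> {1..n}" using r_in[OF that] Sn(1) by blast
        ultimately show ?thesis by simp
      qed
      have r_image: "r ` {..<k} = S"
      proof -
        have "enumerate S ` {..<k} = S"
          using finite_bij_enumerate[OF fin] Sn(3) by (simp add: bij_betw_def)
        then show ?thesis unfolding r_def by simp
      qed
      define e where "e x = (if x < k then r (Suc x) - Suc (r x) else 0)" for x
      have r0: "r 0 = 1"
      proof -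
        have "r 0 = (LEAST i. i \<in> S)" using assms unfolding r_def by (simp add: enumerate_0)
        also have "\<dots> = 1" using Sn(1,2) by (intro Least_equality) auto
        finally show ?thesis .
      qed
      have s: "start_sequence e x = r x" if "x \<le> k" for x
        using that
      proof (induction x)
        case (Suc x)
        then show ?case using r_less[of x] by (simp add: start_sequence_simps e_def)
      qed (simp add: start_sequence_simps r0)
      have "1 \<le> e x" if "Suc x < k" for x
      proof -
        have "r (Suc x) \<noteq> Suc (r x)"
          using sep[OF r_in[of x]] r_in[of "Suc x"] that by auto
        then show ?thesis using r_less[of x] that by (simp add: e_def)
      qed
      moreover have "(\<Sum>x<k. e x) + k = n"
        using s[of k] by (simp add: start_sequence_def sum_Suc r_def)
      ultimately have "e \<in> run_excesses n k"
        unfolding run_excesses_def by (simp add: e_def)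
      moreover have "start_sequence e ` {..<k} = S"
        using s r_image by (metis (no_types, lifting) image_cong lessThan_iff less_imp_le)
      ultimately show "S \<in> (\<lambda>e. start_sequence e ` {..<k}) ` run_excesses n k" by blast
    qed
  qed
qed

lemma gap_exists:
  fixes s :: "nat \<Rightarrow> nat"
  assumes "s 0 \<le> i" "i < s k"
  obtains x where "x < k" "s x \<le> i" "i < s (Suc x)"
  using assms
proof (induction k arbitrary: thesis)
  case (Suc k)
  show ?case
  proof (cases "i < s k")
    case True
    then obtain x where "x < k" "s x \<le> i" "i < s (Suc x)" using Suc.IH Suc.prems by blast
    then show ?thesis using Suc.prems(1)[of x] by simp
  next
    case False
    then show ?thesis using Suc.prems by (intro Suc.prems(1)[of k]) auto
  qed
qed simp

text \<open>Sort the pairs by the run \<open>x\<close> of the first component, which is one of \<open>e x\<close> positions;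
  the second component then ranges over all positions behind that run.\<close>

lemma card_possible_inversions:
  assumes e: "e \<in> run_excesses n k"
  shows "card (possible_inversions n (start_sequence e ` {..<k})) =
    (\<Sum>x<k. e x * (\<Sum>y\<in>{x<..<k}. Suc (e y)))"
proof -
  let ?s = "start_sequence e"
  let ?R = "\<lambda>x. {?s x<..<?s (Suc x)} \<times> {?s (Suc x)..n}"
  note less = strict_mono_less[OF strict_mono_start_sequence[of e]]
    and less_eq = strict_mono_less_eq[OF strict_mono_start_sequence[of e]]
  note s_end = start_sequence_end[OF e]
  have pos: "1 \<le> ?s x" for x by (simp add: start_sequence_def)
  have eq: "possible_inversions n (?s ` {..<k}) = (\<Union>x<k. ?R x)"
  proof (intro equalityI subsetI)
    fix z assume "z \<in> possible_inversions n (?s ` {..<k})"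
    then obtain i j y where z: "z = (i, j)" and ij: "1 \<le> i" "i < j" "j \<le> n"
      and i: "i \<notin> ?s ` {..<k}" and y: "y < k" "i < ?s y" "?s y \<le> j"
      unfolding possible_inversions_def by auto
    have "?s 0 \<le> i" "i < ?s k" using ij s_end by (auto simp: start_sequence_simps)
    then obtain x where x: "x < k" "?s x \<le> i" "i < ?s (Suc x)" by (rule gap_exists)
    have "i \<noteq> ?s x" using i x(1) by blast
    moreover have "?s x < ?s y" using x(2) y(2) by simp
    then have "Suc x \<le> y" using less[of x y] by simp
    then have "?s (Suc x) \<le> j" using less_eq[of "Suc x" y] y(3) by simp
    ultimately have "z \<in> ?R x" using z x ij by auto
    then show "z \<in> (\<Union>x<k. ?R x)" using x(1) by blast
  next
    fix z assume "z \<in> (\<Union>x<k. ?R x)"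
    then obtain x i j where x: "x < k" and z: "z = (i, j)"
      and ij: "?s x < i" "i < ?s (Suc x)" "?s (Suc x) \<le> j" "j \<le> n" by auto
    have "i \<noteq> ?s y" for y
      using ij(1,2) less[of x y] less[of y "Suc x"] by auto
    moreover have "Suc x < k"
      using less[of "Suc x" k] ij(3,4) s_end by simp
    ultimately show "z \<in> possible_inversions n (?s ` {..<k})"
      using z ij pos[of x] unfolding possible_inversions_def by auto
  qed
  have "card (\<Union>x<k. ?R x) = (\<Sum>x<k. card (?R x))"
  proof (rule card_UN_disjoint)
    show "\<forall>x\<in>{..<k}. \<forall>y\<in>{..<k}. x \<noteq> y \<longrightarrow> ?R x \<inter> ?R y = {}"
    proof (intro ballI impI)
      have *: "?R x \<inter> ?R y = {}" if "x < y" for x y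
        using less_eq[of "Suc x" y] that by auto
      fix x y :: nat assume "x \<noteq> y"
      then show "?R x \<inter> ?R y = {}" using *[of x y] *[of y x] by (cases "x < y") auto
    qed
  qed auto
  also have "\<dots> = (\<Sum>x<k. e x * (\<Sum>y\<in>{x<..<k}. Suc (e y)))"
  proof (rule sum.cong)
    fix x assume x: "x \<in> {..<k}"
    have "(\<Sum>y<k. Suc (e y)) = (\<Sum>y<Suc x. Suc (e y)) + (\<Sum>y\<in>{x<..<k}. Suc (e y))"
    proof -
      have "{..<k} = {..<Suc x} \<union> {x<..<k}" "{..<Suc x} \<inter> {x<..<k} = {}" using x by auto
      then show ?thesis by (simp only: sum.union_disjoint finite_lessThan finite_greaterThanLessThan)
    qed
    then have "Suc n = ?s (Suc x) + (\<Sum>y\<in>{x<..<k}. Suc (e y))"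
      using s_end unfolding start_sequence_def by linarith
    then have "card {?s (Suc x)..n} = (\<Sum>y\<in>{x<..<k}. Suc (e y))" by simp
    moreover have "card {?s x<..<?s (Suc x)} = e x" by (simp add: start_sequence_simps)
    ultimately show "card (?R x) = e x * (\<Sum>y\<in>{x<..<k}. Suc (e y))"
      by (simp only: card_cartesian_product)
  qed simp
  finally show ?thesis unfolding eq .
qed

lemma sum_square_pairs:
  fixes f :: "nat \<Rightarrow> int"
  shows "2 * (\<Sum>x<k. \<Sum>y\<in>{x<..<k}. f x * f y) + (\<Sum>x<k. (f x)\<^sup>2) = (\<Sum>x<k. f x)\<^sup>2"
proof (induction k)
  case (Suc k)
  have "(\<Sum>x<Suc k. \<Sum>y\<in>{x<..<Suc k}. f x * f y) =
      (\<Sum>x<k. (\<Sum>y\<in>{x<..<k}. f x * f y) + f x * f k)"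
  proof -
    have "{x<..<Suc k} = insert k {x<..<k}" if "x < k" for x using that by auto
    moreover have "{k<..<Suc k} = {}" by auto
    ultimately show ?thesis by (simp add: add.commute)
  qed
  also have "\<dots> = (\<Sum>x<k. \<Sum>y\<in>{x<..<k}. f x * f y) + (\<Sum>x<k. f x) * f k"
    by (simp add: sum.distrib sum_distrib_right)
  finally show ?case using Suc by (simp add: algebra_simps power2_eq_square)
qed simp

text \<open>With \<open>c x = k - 1 - x\<close>, the number of runs after run \<open>x\<close>, the count above is the sum of
  \<open>e x * c x\<close> and of the products \<open>e x * e y\<close> over \<open>x < y\<close>. Since the sum of the excesses is
  fixed, the products contribute a constant minus half the sum of squares, and completing
  the square turns maximising inversions into minimising a sum of squares.\<close>

lemma possible_inversions_complete_square:
  assumes e: "e \<in> run_excesses n k"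
  shows "2 * int (card (possible_inversions n (start_sequence e ` {..<k}))) +
      (\<Sum>x<k. (int (e x) - (int k - 1 - int x))\<^sup>2) =
    (int n - int k)\<^sup>2 + (\<Sum>x<k. (int k - 1 - int x)\<^sup>2)"
proof -
  have "int (card (possible_inversions n (start_sequence e ` {..<k}))) =
      (\<Sum>x<k. \<Sum>y\<in>{x<..<k}. int (e x) * int (e y)) + (\<Sum>x<k. int (e x) * (int k - 1 - int x))"
    unfolding card_possible_inversions[OF e]
  proof (simp only: of_nat_sum flip: sum.distrib, rule sum.cong)
    fix x assume "x \<in> {..<k}"
    then have "int (\<Sum>y\<in>{x<..<k}. Suc (e y)) = (\<Sum>y\<in>{x<..<k}. int (e y)) + (int k - 1 - int x)"
      by (simp add: sum_Suc of_nat_diff)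
    then show "int (e x * (\<Sum>y\<in>{x<..<k}. Suc (e y))) =
      (\<Sum>y\<in>{x<..<k}. int (e x) * int (e y)) + int (e x) * (int k - 1 - int x)"
      by (simp only: of_nat_mult distrib_left) (simp only: sum_distrib_left)
  qed simp
  moreover have "(\<Sum>x<k. (int (e x) - (int k - 1 - int x))\<^sup>2) = (\<Sum>x<k. (int (e x))\<^sup>2)
     + (\<Sum>x<k. (int k - 1 - int x)\<^sup>2) - 2 * (\<Sum>x<k. int (e x) * (int k - 1 - int x))"
    by (simp only: power2_diff sum.distrib sum_subtractf sum_distrib_left mult.assoc)
  moreover have "(\<Sum>x<k. int (e x)) = int n - int k"
  proof -
    have "(\<Sum>x<k. e x) + k = n" using e unfolding run_excesses_def by simp
    then have "int (\<Sum>x<k. e x) + int k = int n" by (simp only: flip: of_nat_add)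
    then show ?thesis by simp
  qed
  ultimately show ?thesis
    using sum_square_pairs[where f = "\<lambda>x. int (e x)" and k = k] by simp
qed

section \<open>Least squares with lower bounds\<close>

text \<open>Minimising a sum of squares over integer points with a fixed coordinate sum and lower
  bounds \<open>L\<close>. Subtracting \<open>(2 * t + 1)\<close> times the fixed sum is harmless, and afterwards the
  coordinates can be optimised one by one: the parabola \<open>a\<^sup>2 - (2 * t + 1) * a\<close> in
  \<open>a = e x - c x\<close> has on the integers exactly the two minima \<open>t\<close> and \<open>t + 1\<close>. On \<open>T\<close> the lower
  bound admits both; outside \<open>T\<close> the lower bound lies at or to the
  right of \<open>t + 1\<close>, which forces \<open>e x = L x\<close>. The sum leaves \<open>d\<close> coordinates of \<open>T\<close> at the
  upper of the two minima.\<close>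

lemma bounded_least_squares:
  fixes c :: "'a \<Rightarrow> int" and L :: "'a \<Rightarrow> nat" and t V :: int and d :: nat
  assumes fin: "finite I" and T: "T \<subseteq> I" and d: "d \<le> card T"
    and low: "\<And>x. x \<in> T \<Longrightarrow> int (L x) \<le> c x + t"
    and high: "\<And>x. x \<in> I - T \<Longrightarrow> c x + t < int (L x)"
    and F: "F = {e. (\<forall>x. x \<notin> I \<longrightarrow> e x = 0) \<and> (\<forall>x\<in>I. L x \<le> e x) \<and>
      (\<Sum>x\<in>I. int (e x)) = (\<Sum>x\<in>T. c x + t) + (\<Sum>x\<in>I - T. int (L x)) + int d}"
    and V: "V = int d * (t + 1)\<^sup>2 + (int (card T) - int d) * t\<^sup>2 + (\<Sum>x\<in>I - T. (int (L x) - c x)\<^sup>2)"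
  shows "e \<in> F \<Longrightarrow> V \<le> (\<Sum>x\<in>I. (int (e x) - c x)\<^sup>2)"
    and "card {e \<in> F. (\<Sum>x\<in>I. (int (e x) - c x)\<^sup>2) = V} = card T choose d"
proof -
  \<comment> \<open>Cost of coordinate \<open>x\<close>, with multiplier \<open>2 * t + 1\<close>, above its minimum.\<close>
  define \<delta> where "\<delta> e x = (if x \<in> T then (int (e x) - c x - t) * (int (e x) - c x - t - 1)
     else (int (e x) - int (L x)) * (int (e x) + int (L x) - 2 * c x - 2 * t - 1))" for e x
  note split = sum.subset_diff[OF T fin]
  have finT: "finite T" using T fin finite_subset by blast
  have \<delta>_sum: "(\<Sum>x\<in>I. \<delta> e x) = (\<Sum>x\<in>I. (int (e x) - c x)\<^sup>2) - V" if e: "e \<in> F" for e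
  proof -
    have "(\<Sum>x\<in>T. \<delta> e x) = (\<Sum>x\<in>T. (int (e x) - c x)\<^sup>2 - (2 * t + 1) * int (e x) + (2 * t + 1) * (c x + t) - t\<^sup>2)"
      by (rule sum.cong) (simp_all add: \<delta>_def algebra_simps power2_eq_square)
    moreover have "(\<Sum>x\<in>I - T. \<delta> e x) = (\<Sum>x\<in>I - T. (int (e x) - c x)\<^sup>2
        - (2 * t + 1) * int (e x) + (2 * t + 1) * int (L x) - (int (L x) - c x)\<^sup>2)"
      by (rule sum.cong) (simp_all add: \<delta>_def algebra_simps power2_eq_square)
    ultimately have "(\<Sum>x\<in>I. \<delta> e x) = (\<Sum>x\<in>I. (int (e x) - c x)\<^sup>2)
        - (2 * t + 1) * (\<Sum>x\<in>I. int (e x)) + (2 * t + 1) * ((\<Sum>x\<in>T. c x + t) + (\<Sum>x\<in>I - T. int (L x)))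
        - int (card T) * t\<^sup>2 - (\<Sum>x\<in>I - T. (int (L x) - c x)\<^sup>2)"
      unfolding split[of "\<delta> e"] split[of "\<lambda>x. (int (e x) - c x)\<^sup>2"] split[of "\<lambda>x. int (e x)"]
      by (simp only: sum.distrib sum_subtractf sum_distrib_left sum_constant distrib_left) simp
    also have "\<dots> = (\<Sum>x\<in>I. (int (e x) - c x)\<^sup>2) - V"
      using e unfolding F V by (simp add: algebra_simps power2_eq_square)
    finally show ?thesis .
  qed
  have \<delta>_T: "0 \<le> \<delta> e x" "\<delta> e x = 0 \<longleftrightarrow> int (e x) = c x + t \<or> int (e x) = c x + t + 1" if "x \<in> T" for e x
  proof -
    have "0 \<le> a * (a - 1)" for a :: int
      by (cases "a \<le> 0") (auto intro: mult_nonneg_nonneg mult_nonpos_nonpos)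
    then show "0 \<le> \<delta> e x" using that by (simp add: \<delta>_def)
    show "\<delta> e x = 0 \<longleftrightarrow> int (e x) = c x + t \<or> int (e x) = c x + t + 1"
      using that by (auto simp: \<delta>_def)
  qed
  have \<delta>_high: "0 \<le> \<delta> e x" "\<delta> e x = 0 \<longleftrightarrow> e x = L x" if "e \<in> F" "x \<in> I - T" for e x
  proof -
    have "L x \<le> e x" using that F by auto
    moreover from this have "0 < int (e x) + int (L x) - 2 * c x - 2 * t - 1"
      using high[OF that(2)] by linarith
    ultimately show "0 \<le> \<delta> e x" "\<delta> e x = 0 \<longleftrightarrow> e x = L x"
      using that by (auto simp: \<delta>_def)
  qed
  have nonneg: "0 \<le> \<delta> e x" if "e \<in> F" "x \<in> I" for e x
    using that \<delta>_T(1)[of x e] \<delta>_high(1)[of e x] by (cases "x \<in> T") auto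
  show "V \<le> (\<Sum>x\<in>I. (int (e x) - c x)\<^sup>2)" if "e \<in> F" for e
    using sum_nonneg[of I "\<delta> e"] nonneg[OF that] \<delta>_sum[OF that] by simp
  have minimal: "(\<Sum>x\<in>I. (int (e x) - c x)\<^sup>2) = V \<longleftrightarrow>
      (\<forall>x\<in>T. int (e x) = c x + t \<or> int (e x) = c x + t + 1) \<and> (\<forall>x\<in>I - T. e x = L x)" if e: "e \<in> F" for e
  proof -
    have "(\<Sum>x\<in>I. (int (e x) - c x)\<^sup>2) = V \<longleftrightarrow> (\<Sum>x\<in>I. \<delta> e x) = 0"
      using \<delta>_sum[OF e] by auto
    also have "\<dots> \<longleftrightarrow> (\<forall>x\<in>I. \<delta> e x = 0)"
      using nonneg[OF e] by (intro sum_nonneg_eq_0_iff fin)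
    also have "\<dots> \<longleftrightarrow> (\<forall>x\<in>T. \<delta> e x = 0) \<and> (\<forall>x\<in>I - T. \<delta> e x = 0)" using T by blast
    finally show ?thesis using \<delta>_T(2) \<delta>_high(2)[OF e] by simp
  qed
  \<comment> \<open>The minimiser that takes the upper value exactly on \<open>D\<close>.\<close>
  define w where "w D x = (if x \<in> T then nat (c x + t + (if x \<in> D then 1 else 0))
      else if x \<in> I then L x else 0)" for D x
  have w_T: "int (w D x) = c x + t + (if x \<in> D then 1 else 0)" if "x \<in> T" for D x
    using low[OF that] that by (simp add: w_def)
  have sum_T: "(\<Sum>x\<in>T. c x + t + (if x \<in> D then 1 else 0)) = (\<Sum>x\<in>T. c x + t) + int (card D)"
    if "D \<subseteq> T" for D
  proof -
    have "(\<Sum>x\<in>T. if x \<in> D then 1 else 0) = (\<Sum>x\<in>T \<inter> D. 1 :: int)"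
      using finT by (simp add: sum.If_cases)
    also have "T \<inter> D = D" using that by blast
    finally show ?thesis by (simp add: sum.distrib)
  qed
  have "bij_betw w {D. D \<subseteq> T \<and> card D = d} {e \<in> F. (\<Sum>x\<in>I. (int (e x) - c x)\<^sup>2) = V}"
  proof (rule bij_betw_imageI)
    show "inj_on w {D. D \<subseteq> T \<and> card D = d}"
    proof (rule inj_onI)
      fix D D' assume D: "D \<in> {D. D \<subseteq> T \<and> card D = d}" "D' \<in> {D. D \<subseteq> T \<and> card D = d}" and "w D = w D'"
      then have "x \<in> D \<longleftrightarrow> x \<in> D'" if "x \<in> T" for x
        using w_T[OF that, of D] w_T[OF that, of D'] by (simp split: if_splits)
      then show "D = D'" using D by blast
    qed
    show "w ` {D. D \<subseteq> T \<and> card D = d} = {e \<in> F. (\<Sum>x\<in>I. (int (e x) - c x)\<^sup>2) = V}"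
    proof (intro equalityI subsetI)
      fix e assume "e \<in> w ` {D. D \<subseteq> T \<and> card D = d}"
      then obtain D where e: "e = w D" and D: "D \<subseteq> T" "card D = d" by blast
      have "(\<Sum>x\<in>T. int (e x)) = (\<Sum>x\<in>T. c x + t) + int d"
        using sum_T[OF D(1)] w_T D(2) by (simp add: e)
      moreover have "(\<Sum>x\<in>I - T. int (e x)) = (\<Sum>x\<in>I - T. int (L x))"
        by (simp add: e w_def)
      ultimately have "(\<Sum>x\<in>I. int (e x)) = (\<Sum>x\<in>T. c x + t) + (\<Sum>x\<in>I - T. int (L x)) + int d"
        unfolding split by simp
      moreover have "L x \<le> e x" if "x \<in> I" for x
      proof (cases "x \<in> T")
        case True
        then have "int (L x) \<le> int (e x)" using w_T[OF True, of D] low[OF True] by (simp add: e)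
        then show ?thesis by simp
      qed (simp add: e w_def that)
      ultimately have "e \<in> F" unfolding F using T by (auto simp: e w_def)
      then show "e \<in> {e \<in> F. (\<Sum>x\<in>I. (int (e x) - c x)\<^sup>2) = V}"
        using minimal[of e] w_T[of _ D] T by (simp add: e) (simp add: w_def)
    next
      fix e assume "e \<in> {e \<in> F. (\<Sum>x\<in>I. (int (e x) - c x)\<^sup>2) = V}"
      then have e: "e \<in> F" and e_T: "\<And>x. x \<in> T \<Longrightarrow> int (e x) = c x + t \<or> int (e x) = c x + t + 1"
        and e_high: "\<And>x. x \<in> I - T \<Longrightarrow> e x = L x"
        using minimal by auto
      define D where "D = {x \<in> T. int (e x) = c x + t + 1}"
      have eq: "int (e x) = c x + t + (if x \<in> D then 1 else 0)" if "x \<in> T" for x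
        using e_T[OF that] that by (auto simp: D_def)
      have D: "D \<subseteq> T" by (auto simp: D_def)
      have "e = w D"
      proof
        fix x show "e x = w D x"
        proof (cases "x \<in> T")
          case True
          then have "int (e x) = int (w D x)" using eq[OF True] w_T[OF True, of D] by simp
          then show ?thesis by simp
        next
          case False
          then show ?thesis using e_high[of x] e F by (auto simp: w_def)
        qed
      qed
      moreover have "card D = d"
      proof -
        have "(\<Sum>x\<in>T. int (e x)) = (\<Sum>x\<in>T. c x + t) + int (card D)"
          using sum_T[OF D] eq by simp
        moreover have "(\<Sum>x\<in>I - T. int (e x)) = (\<Sum>x\<in>I - T. int (L x))"
          using e_high by simp
        moreover have "(\<Sum>x\<in>I. int (e x)) = (\<Sum>x\<in>T. c x + t) + (\<Sum>x\<in>I - T. int (L x)) + int d"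
          using e F by simp
        ultimately show ?thesis unfolding split by simp
      qed
      ultimately show "e \<in> w ` {D. D \<subseteq> T \<and> card D = d}" using D by blast
    qed
  qed
  then show "card {e \<in> F. (\<Sum>x\<in>I. (int (e x) - c x)\<^sup>2) = V} = card T choose d"
    using n_subsets[OF finT, of d] by (simp flip: bij_betw_same_card)
qed

section \<open>From permutations to run starts\<close>

text \<open>A permutation attains the overall maximum only if its inversions are all possible
  inversions of its run starts, so it can be recovered from its run starts.\<close>

lemma max_inv_via_start_sets:
  assumes "1 \<le> n"
    and le: "\<And>S. S \<in> start_sets n k \<Longrightarrow> card (possible_inversions n S) \<le> m"
    and ex: "\<exists>S \<in> start_sets n k. card (possible_inversions n S) = m"
  shows "max_inv n k = m"
    and "card (maximizers n k) = card {S \<in> start_sets n k. card (possible_inversions n S) = m}"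
proof -
  let ?P = "run_sorted_perms n k"
  have fin: "finite ?P"
    by (rule finite_subset[OF _ finite_permutations[of "{1..n}"]]) (auto simp: run_sorted_perms_def)
  have bound: "inv_count n p \<le> card (possible_inversions n (run_starts n p))" if "p \<in> ?P" for p
    unfolding inv_count_def
    using inversions_subset[OF that] finite_possible_inversions by (intro card_mono)
  have starts: "run_starts n p \<in> start_sets n k" if "p \<in> ?P" for p
    using run_starts_in_start_sets[OF that assms(1)] .
  have le_m: "inv_count n p \<le> m" if "p \<in> ?P" for p
    using bound[OF that] le[OF starts[OF that]] by linarith
  show max: "max_inv n k = m"
    unfolding max_inv_def
  proof (rule Max_eqI)
    obtain S where S: "S \<in> start_sets n k" "card (possible_inversions n S) = m" using ex by blast
    obtain p where "p \<in> ?P" "inversions n p = possible_inversions n S"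
      using attaining_permutation_exists[OF S(1)] by blast
    then show "m \<in> inv_count n ` ?P"
      using S(2) by (intro image_eqI[of _ _ p]) (simp_all add: inv_count_def)
  qed (use fin le_m in auto)
  have all: "inversions n p = possible_inversions n (run_starts n p)"
    "card (possible_inversions n (run_starts n p)) = m" if p: "p \<in> ?P" "inv_count n p = m" for p
  proof -
    show card: "card (possible_inversions n (run_starts n p)) = m"
      using bound[OF p(1)] le[OF starts[OF p(1)]] p(2) by linarith
    show "inversions n p = possible_inversions n (run_starts n p)"
      using card_subset_eq[OF finite_possible_inversions inversions_subset[OF p(1)]] card p(2)
      unfolding inv_count_def by simp
  qed
  have "bij_betw (run_starts n) {p \<in> ?P. inv_count n p = m}
      {S \<in> start_sets n k. card (possible_inversions n S) = m}"
  proof (rule bij_betw_imageI)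
    show "inj_on (run_starts n) {p \<in> ?P. inv_count n p = m}"
    proof (rule inj_onI)
      fix p q assume p: "p \<in> {p \<in> ?P. inv_count n p = m}" and q: "q \<in> {p \<in> ?P. inv_count n p = m}"
        and eq: "run_starts n p = run_starts n q"
      have "inversions n p = inversions n q" using all(1)[of p] all(1)[of q] p q eq by simp
      then show "p = q" using p q
        by (intro permutes_eq_if_inversions_eq) (auto simp: run_sorted_perms_def)
    qed
    show "run_starts n ` {p \<in> ?P. inv_count n p = m} =
      {S \<in> start_sets n k. card (possible_inversions n S) = m}"
    proof (intro equalityI subsetI)
      fix S assume "S \<in> run_starts n ` {p \<in> ?P. inv_count n p = m}"
      then show "S \<in> {S \<in> start_sets n k. card (possible_inversions n S) = m}"
        using all(2) starts by blast
    next
      fix S assume S: "S \<in> {S \<in> start_sets n k. card (possible_inversions n S) = m}"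
      then obtain p where "p \<in> ?P" "run_starts n p = S" "inversions n p = possible_inversions n S"
        using attaining_permutation_exists[of S n k] by blast
      then show "S \<in> run_starts n ` {p \<in> ?P. inv_count n p = m}"
        using S by (intro image_eqI[of _ _ p]) (simp_all add: inv_count_def)
    qed
  qed
  then show "card (maximizers n k) = card {S \<in> start_sets n k. card (possible_inversions n S) = m}"
    unfolding maximizers_def max by (rule bij_betw_same_card)
qed

section \<open>The maximum and its multiplicity in terms of a free set of runs\<close>

text \<open>The set \<open>T\<close> collects the runs whose lengths are balanced against each other: their excesses deviate from the
  unconstrained ideal \<open>c\<close> by \<open>t\<close> or \<open>t + 1\<close>, while the other runs have their least excess.\<close>

lemma max_inv_via_least_squares:
  fixes n k d :: nat and t :: int and c :: "nat \<Rightarrow> int" and L :: "nat \<Rightarrow> nat"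
  defines "c \<equiv> \<lambda>x. int k - 1 - int x" and "L \<equiv> \<lambda>x. if Suc x < k then 1 else 0"
  assumes k: "1 \<le> k" and T: "T \<subseteq> {..<k}" and d: "d \<le> card T"
    and low: "\<And>x. x \<in> T \<Longrightarrow> int (L x) \<le> c x + t"
    and high: "\<And>x. x \<in> {..<k} - T \<Longrightarrow> c x + t < int (L x)"
    and n: "int n - int k = (\<Sum>x\<in>T. c x + t) + (\<Sum>x\<in>{..<k} - T. int (L x)) + int d"
  shows "2 * int (max_inv n k) = (int n - int k)\<^sup>2 + (\<Sum>x<k. (c x)\<^sup>2) -
      (int d * (t + 1)\<^sup>2 + (int (card T) - int d) * t\<^sup>2 + (\<Sum>x\<in>{..<k} - T. (int (L x) - c x)\<^sup>2))"
    and "card (maximizers n k) = card T choose d"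
proof -
  define V where "V = int d * (t + 1)\<^sup>2 + (int (card T) - int d) * t\<^sup>2 +
    (\<Sum>x\<in>{..<k} - T. (int (L x) - c x)\<^sup>2)"
  define E where "E = run_excesses n k"
  define M where "M e = card (possible_inversions n (start_sequence e ` {..<k}))" for e
  have "(\<Sum>x<k. e x) + k = n \<longleftrightarrow> (\<Sum>x<k. int (e x)) = int n - int k" for e
    by (simp flip: of_nat_sum of_nat_add add: eq_diff_eq)
  then have E: "E = {e. (\<forall>x. x \<notin> {..<k} \<longrightarrow> e x = 0) \<and> (\<forall>x\<in>{..<k}. L x \<le> e x) \<and>
      (\<Sum>x\<in>{..<k}. int (e x)) = (\<Sum>x\<in>T. c x + t) + (\<Sum>x\<in>{..<k} - T. int (L x)) + int d}"
    unfolding E_def run_excesses_def n[symmetric] by (auto simp: L_def not_less)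
  note least_squares = bounded_least_squares[OF finite_lessThan T d low high E V_def]
  have opt: "V \<le> (\<Sum>x<k. (int (e x) - c x)\<^sup>2)" if "e \<in> E" for e
    by (rule least_squares(1)[OF _ _ that])
  have count: "card {e \<in> E. (\<Sum>x<k. (int (e x) - c x)\<^sup>2) = V} = card T choose d"
    by (rule least_squares(2))
  have square: "2 * int (M e) + (\<Sum>x<k. (int (e x) - c x)\<^sup>2) = (int n - int k)\<^sup>2 + (\<Sum>x<k. (c x)\<^sup>2)"
    if "e \<in> E" for e
    using possible_inversions_complete_square[of e n k] that unfolding M_def E_def c_def .
  have "card T choose d > 0" using d by simp
  then have "{e \<in> E. (\<Sum>x<k. (int (e x) - c x)\<^sup>2) = V} \<noteq> {}"
    using count by (intro notI) simp
  then obtain e0 where e0: "e0 \<in> E" "(\<Sum>x<k. (int (e0 x) - c x)\<^sup>2) = V" by blast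
  define m where "m = M e0"
  have m: "2 * int m = (int n - int k)\<^sup>2 + (\<Sum>x<k. (c x)\<^sup>2) - V"
    using square[OF e0(1)] e0(2) by (simp add: m_def)
  have le: "M e \<le> m" if "e \<in> E" for e
    using square[OF that] opt[OF that] m by simp
  have iff: "M e = m \<longleftrightarrow> (\<Sum>x<k. (int (e x) - c x)\<^sup>2) = V" if "e \<in> E" for e
    using square[OF that] m by auto
  note bij = bij_betw_run_excesses_start_sets[OF k, of n]
  then have image: "start_sets n k = (\<lambda>e. start_sequence e ` {..<k}) ` E"
    unfolding E_def bij_betw_def by simp
  have "k \<le> n" using e0(1) unfolding E_def run_excesses_def by auto
  then have "1 \<le> n" using k by simp
  have le_S: "card (possible_inversions n S) \<le> m" if "S \<in> start_sets n k" for S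
    using that le unfolding image M_def by auto
  have "\<exists>S\<in>start_sets n k. card (possible_inversions n S) = m"
    using e0(1) unfolding image m_def M_def by blast
  note start_sets = max_inv_via_start_sets[OF \<open>1 \<le> n\<close> le_S this]
  have *: "max_inv n k = m"
    by (rule start_sets(1))
  have **: "card (maximizers n k) = card {S \<in> start_sets n k. card (possible_inversions n S) = m}"
    by (rule start_sets(2))
  show "2 * int (max_inv n k) = (int n - int k)\<^sup>2 + (\<Sum>x<k. (c x)\<^sup>2) -
      (int d * (t + 1)\<^sup>2 + (int (card T) - int d) * t\<^sup>2 + (\<Sum>x\<in>{..<k} - T. (int (L x) - c x)\<^sup>2))"
    using m unfolding * V_def .
  have "card {S \<in> start_sets n k. card (possible_inversions n S) = m} = card {e \<in> E. M e = m}"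
  proof -
    have "{S \<in> start_sets n k. card (possible_inversions n S) = m} =
        (\<lambda>e. start_sequence e ` {..<k}) ` {e \<in> E. M e = m}"
      unfolding image M_def by blast
    moreover have "inj_on (\<lambda>e. start_sequence e ` {..<k}) {e \<in> E. M e = m}"
      using bij unfolding bij_betw_def E_def by (auto intro: inj_on_subset)
    ultimately show ?thesis by (simp add: card_image)
  qed
  also have "{e \<in> E. M e = m} = {e \<in> E. (\<Sum>x<k. (int (e x) - c x)\<^sup>2) = V}"
    using iff by blast
  finally show "card (maximizers n k) = card T choose d"
    using count ** by simp
qed

section \<open>The two parameter regimes\<close>

lemma Suc_choose_two: "Suc r choose 2 = (r choose 2) + r"
  by (simp add: numeral_2_eq_2)

lemma sum_of_squares_reversed:
  "6 * (\<Sum>x<k. (int k - 1 - int x)\<^sup>2) = (int k - 1) * int k * (2 * int k - 1)"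
proof -
  have "(\<Sum>x<k. (int k - 1 - int x)\<^sup>2) = (\<Sum>x<k. (int (k - Suc x))\<^sup>2)"
    by (rule sum.cong) (auto simp: of_nat_diff)
  also have "\<dots> = (\<Sum>x<k. (int x)\<^sup>2)" by (rule sum.nat_diff_reindex)
  also have "6 * \<dots> = (int k - 1) * int k * (2 * int k - 1)"
    by (induction k) (simp_all add: algebra_simps power2_eq_square)
  finally show ?thesis .
qed

lemma sum_reversed: "(\<Sum>x<k. int k - 1 - int x) = int (k choose 2)"
proof -
  have "(\<Sum>x<k. int k - 1 - int x) = (\<Sum>x<k. int (k - Suc x))"
    by (rule sum.cong) (auto simp: of_nat_diff)
  also have "\<dots> = (\<Sum>x<k. int x)" by (rule sum.nat_diff_reindex)
  also have "\<dots> = int (k choose 2)"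
    by (induction k) (simp_all add: Suc_choose_two)
  finally show ?thesis .
qed

text \<open>The triangular numbers \<open>r choose 2\<close> and \<open>r + 1 choose 2\<close> differ by \<open>r\<close>.\<close>

lemma triangular_decomposition: "\<exists>r d. 1 \<le> r \<and> d < r \<and> m = (r choose 2) + d"
proof (induction m)
  case 0
  show ?case by (intro exI[of _ 1] exI[of _ 0]) simp
next
  case (Suc m)
  then obtain r d where rd: "1 \<le> r" "d < r" "m = (r choose 2) + d" by blast
  show ?case
  proof (cases "Suc d < r")
    case True
    then show ?thesis using rd by (intro exI[of _ r] exI[of _ "Suc d"]) simp
  next
    case False
    then show ?thesis using rd
      by (intro exI[of _ "Suc r"] exI[of _ 0]) (simp add: Suc_choose_two)
  qed
qed

text \<open>As \<open>k + 1 choose 2 = (k - 1 choose 2) + 2 * k - 1\<close>, the bound on \<open>n\<close> keeps the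
  triangular index below \<open>k - 1\<close>.\<close>

lemma params_small_exists:
  assumes "1 \<le> k" "2 * k - 1 \<le> n" "n < (k + 1 choose 2)"
  shows "\<exists>r d. params_small n k r d"
proof -
  obtain r d where rd: "1 \<le> r" "d < r" "n - (2 * k - 1) = (r choose 2) + d"
    using triangular_decomposition by blast
  obtain j where j: "k = Suc j" using assms(1) by (cases k) auto
  have "r + 2 \<le> k"
  proof (rule ccontr)
    assume "\<not> r + 2 \<le> k"
    then have "(j choose 2) \<le> (r choose 2)" using j by (intro binomial_right_mono) auto
    then show False using rd(3) assms(2,3) by (simp add: j Suc_choose_two)
  qed
  then show ?thesis using rd assms(2) unfolding params_small_def by (intro exI[of _ r] exI[of _ d]) auto
qed

lemma params_large_exists:
  assumes "1 \<le> k" "(k + 1 choose 2) \<le> n"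
  shows "\<exists>r d. params_large n k r d"
proof -
  let ?m = "n - (k + 1 choose 2)"
  have "n = (k + 1 choose 2) + (?m div k) * k + ?m mod k"
    using assms(2) div_mult_mod_eq[of ?m k] by linarith
  then show ?thesis using assms(1) unfolding params_large_def
    by (intro exI[of _ "?m div k"] exI[of _ "?m mod k"]) simp
qed

text \<open>The ideal excesses \<open>k - 1 - x\<close> respect all lower bounds and add up to
  \<open>k choose 2\<close>. So every run is free, and the surplus \<open>r * k + d\<close> is spread evenly.\<close>

lemma max_inv_large:
  assumes k: "1 \<le> k" and params: "params_large n k r d"
  shows "2 * int (max_inv n k) = (int n - int k)\<^sup>2 + (\<Sum>x<k. (int k - 1 - int x)\<^sup>2)
      - (int d * (int r + 1)\<^sup>2 + (int k - int d) * (int r)\<^sup>2)"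
    and "card (maximizers n k) = k choose d"
proof -
  have n: "n = (k choose 2) + k + r * k + d" and d: "d < k"
    using params unfolding params_large_def by (simp_all add: Suc_choose_two)
  have "int n - int k = (\<Sum>x<k. int k - 1 - int x + int r)
      + (\<Sum>x\<in>{..<k} - {..<k}. int (if Suc x < k then 1 else 0)) + int d"
    by (simp only: sum.distrib sum_reversed n) (simp add: algebra_simps)
  note opt = max_inv_via_least_squares[OF k subset_refl _ _ _ this]
  show "2 * int (max_inv n k) = (int n - int k)\<^sup>2 + (\<Sum>x<k. (int k - 1 - int x)\<^sup>2)
      - (int d * (int r + 1)\<^sup>2 + (int k - int d) * (int r)\<^sup>2)"
    using opt(1) d by simp
  show "card (maximizers n k) = k choose d"
    using opt(2) d by simp
qed

text \<open>Here the ideal excesses are too large in total. All of them are lowered by the same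
  amount \<open>k - 1 - r\<close> as far as the lower bounds permit: this leaves \<open>r - x\<close> for the first \<open>r\<close>
  runs, which are the free ones, while the later runs keep their least excess, one for all
  but the last and zero for the last. The remainder \<open>d\<close> goes to the free runs.\<close>

lemma max_inv_small:
  assumes params: "params_small n k r d"
  shows "2 * int (max_inv n k) = (int n - int k)\<^sup>2 + (\<Sum>x<k. (int k - 1 - int x)\<^sup>2)
      - (int d * (int r + 2 - int k)\<^sup>2 + (int r - int d) * (int r + 1 - int k)\<^sup>2
         + (\<Sum>x<k - 1 - r. (int (k - 1 - r) - 1 - int x)\<^sup>2))"
    and "card (maximizers n k) = r choose d"
proof -
  have n: "n = 2 * k - 1 + (r choose 2) + d" and r: "1 \<le> r" "r + 2 \<le> k" and d: "d < r"
    using params unfolding params_small_def by simp_all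
  define m where "m = k - 1 - r"
  have k: "k = Suc (m + r)" "1 \<le> k" using r unfolding m_def by simp_all
  have top: "{..<k} - {..<r} = insert (m + r) ((\<lambda>x. x + r) ` {..<m})"
  proof -
    have "{..<k} - {..<r} = insert (m + r) {r..<m + r}" using k by auto
    also have "{r..<m + r} = (\<lambda>x. x + r) ` {..<m}"
      using image_add_atLeastLessThan'[of r 0 m] by (simp add: lessThan_atLeast0)
    finally show ?thesis .
  qed
  have split: "(\<Sum>x\<in>{..<k} - {..<r}. f x) = f (m + r) + (\<Sum>x<m. f (x + r))" for f :: "nat \<Rightarrow> int"
  proof -
    have "(\<Sum>x\<in>(\<lambda>x. x + r) ` {..<m}. f x) = (\<Sum>x<m. f (x + r))"
      by (subst sum.reindex) (simp_all add: inj_on_def)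
    then show ?thesis unfolding top by (subst sum.insert) auto
  qed
  have "(\<Sum>x<r. int k - 1 - int x + (int r + 1 - int k)) = (\<Sum>x<r. (int r - 1 - int x) + 1)"
    by (rule sum.cong) simp_all
  then have "int n - int k = (\<Sum>x<r. int k - 1 - int x + (int r + 1 - int k))
      + (\<Sum>x\<in>{..<k} - {..<r}. int (if Suc x < k then 1 else 0)) + int d"
    unfolding split by (simp only: sum.distrib sum_reversed) (simp add: n k(1))
  note opt = max_inv_via_least_squares[OF k(2) _ _ _ _ this]
  have squares: "(\<Sum>x\<in>{..<k} - {..<r}. (int (if Suc x < k then 1 else 0) - (int k - 1 - int x))\<^sup>2)
      = (\<Sum>x<m. (int m - 1 - int x)\<^sup>2)"
    unfolding split by (simp add: k(1) power2_commute algebra_simps)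
  have prem: "{..<r} \<subseteq> {..<k}" "d \<le> card {..<r}"
    "\<And>x. x \<in> {..<r} \<Longrightarrow> int (if Suc x < k then 1 else 0) \<le> int k - 1 - int x + (int r + 1 - int k)"
    "\<And>x. x \<in> {..<k} - {..<r} \<Longrightarrow> int k - 1 - int x + (int r + 1 - int k) < int (if Suc x < k then 1 else 0)"
    using d r by auto
  show "2 * int (max_inv n k) = (int n - int k)\<^sup>2 + (\<Sum>x<k. (int k - 1 - int x)\<^sup>2)
      - (int d * (int r + 2 - int k)\<^sup>2 + (int r - int d) * (int r + 1 - int k)\<^sup>2
         + (\<Sum>x<k - 1 - r. (int (k - 1 - r) - 1 - int x)\<^sup>2))"
    using opt(1)[OF prem] unfolding squares m_def[symmetric] by (simp add: algebra_simps)
  show "card (maximizers n k) = r choose d"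
    using opt(2)[OF prem] by simp
qed

section \<open>Closed forms\<close>

lemma choose_two_real: "real (n choose 2) = real n * (real n - 1) / 2"
  by (induction n) (simp_all add: Suc_choose_two field_simps)

lemma choose_three_real: "real (n choose 3) = real n * (real n - 1) * (real n - 2) / 6"
proof (induction n)
  case (Suc n)
  have "Suc n choose 3 = (n choose 2) + (n choose 3)"
    using binomial_Suc_Suc[of n 2] by simp
  then show ?case using Suc by (simp add: choose_two_real field_simps)
qed simp

lemma choose_four_real:
  "real (n choose 4) = real n * (real n - 1) * (real n - 2) * (real n - 3) / 24"
proof (induction n)
  case (Suc n)
  have "Suc n choose 4 = (n choose 3) + (n choose 4)"
    using binomial_Suc_Suc[of n 3] by simp
  then show ?case using Suc by (simp add: choose_three_real field_simps)
qed simp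

lemma max_inv_large_real:
  assumes k: "1 \<le> k" and params: "params_large n k r d"
  shows "real (max_inv n k) =
            (3 * real k + 3 * real r + 2) / 4 * real (k + r + 1 choose 3)
            - (3 * real r - 2) / 4 * real (r + 1 choose 3)
            - real (k + r + 1 - d choose 3)
            - (real r * real k + real (k choose 2) + real d) * real (r + 1 choose 2)
            + (real k + real r) * real (d choose 2) - real (d choose 3)"
proof -
  have "n = (k choose 2) + k + r * k + d" and d: "d < k"
    using params unfolding params_large_def by (simp_all add: Suc_choose_two)
  then have n: "real n - real k = real k * (real k - 1) / 2 + real r * real k + real d"
    by (simp add: choose_two_real)
  have "12 * int (max_inv n k) = 6 * (int n - int k)\<^sup>2 + (int k - 1) * int k * (2 * int k - 1)
      - 6 * (int d * (int r + 1)\<^sup>2 + (int k - int d) * (int r)\<^sup>2)"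
  proof -
    have "12 * m = 6 * a + b - 6 * v" if "2 * m = a + s - v" "6 * s = b" for m a s v b :: int
      using that by simp
    from this[OF max_inv_large(1)[OF assms] sum_of_squares_reversed] show ?thesis .
  qed
  then have "real_of_int (12 * int (max_inv n k)) = real_of_int (6 * (int n - int k)\<^sup>2 + (int k - 1) * int k * (2 * int k - 1)
      - 6 * (int d * (int r + 1)\<^sup>2 + (int k - int d) * (int r)\<^sup>2))"
    by (rule arg_cong)
  then have "12 * real (max_inv n k) = 6 * (real n - real k)\<^sup>2 + (real k - 1) * real k * (2 * real k - 1)
      - 6 * (real d * (real r + 1)\<^sup>2 + (real k - real d) * (real r)\<^sup>2)"
    by simp
  then have max: "real (max_inv n k) = (6 * (real k * (real k - 1) / 2 + real r * real k + real d)\<^sup>2 + (real k - 1) * real k * (2 * real k - 1)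
      - 6 * (real d * (real r + 1)\<^sup>2 + (real k - real d) * (real r)\<^sup>2)) / 12"
    unfolding n by simp
  have "real (k + r + 1 - d) = real k + real r + 1 - real d" using d by simp
  then show ?thesis unfolding max choose_two_real choose_three_real
    by (simp add: field_simps power2_eq_square)
qed

lemma max_inv_small_real:
  assumes params: "params_small n k r d"
  shows "real (max_inv n k) =
            real k ^ 2 + (real r ^ 2 - real r + 2 * real d - 2) * real k
            + 3 * real (r + 1 choose 4) - 2 * real (r + 1 choose 3)
            + (real d - 1) * real (r choose 2) - real d * real r
            + (real d ^ 2 - 5 * real d + 2) / 2"
proof -
  have "n = 2 * k - 1 + (r choose 2) + d" and r: "r + 2 \<le> k"
    using params unfolding params_small_def by simp_all
  then have n: "real n - real k = real k - 1 + real r * (real r - 1) / 2 + real d"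
    by (simp add: choose_two_real)
  have "12 * int (max_inv n k) = 6 * (int n - int k)\<^sup>2 + (int k - 1) * int k * (2 * int k - 1)
      - 6 * (int d * (int r + 2 - int k)\<^sup>2 + (int r - int d) * (int r + 1 - int k)\<^sup>2)
      - (int (k - 1 - r) - 1) * int (k - 1 - r) * (2 * int (k - 1 - r) - 1)"
  proof -
    have "12 * m = 6 * a + b - 6 * v - b'"
      if "2 * m = a + s - (v + s')" "6 * s = b" "6 * s' = b'" for m a s v b s' b' :: int
      using that by simp
    from this[OF max_inv_small(1)[OF assms] sum_of_squares_reversed sum_of_squares_reversed]
    show ?thesis .
  qed
  also have "int (k - 1 - r) = int k - 1 - int r" using r by simp
  finally have "real_of_int (12 * int (max_inv n k)) = real_of_int (6 * (int n - int k)\<^sup>2 + (int k - 1) * int k * (2 * int k - 1)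
      - 6 * (int d * (int r + 2 - int k)\<^sup>2 + (int r - int d) * (int r + 1 - int k)\<^sup>2)
      - (int k - 1 - int r - 1) * (int k - 1 - int r) * (2 * (int k - 1 - int r) - 1))"
    by (rule arg_cong)
  then have "12 * real (max_inv n k) = 6 * (real n - real k)\<^sup>2 + (real k - 1) * real k * (2 * real k - 1)
      - 6 * (real d * (real r + 2 - real k)\<^sup>2 + (real r - real d) * (real r + 1 - real k)\<^sup>2)
      - (real k - 1 - real r - 1) * (real k - 1 - real r) * (2 * (real k - 1 - real r) - 1)"
    by simp
  then have max: "real (max_inv n k) = (6 * (real k - 1 + real r * (real r - 1) / 2 + real d)\<^sup>2 + (real k - 1) * real k * (2 * real k - 1)
      - 6 * (real d * (real r + 2 - real k)\<^sup>2 + (real r - real d) * (real r + 1 - real k)\<^sup>2)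
      - (real k - 1 - real r - 1) * (real k - 1 - real r) * (2 * (real k - 1 - real r) - 1)) / 12"
    unfolding n by simp
  show ?thesis unfolding max choose_two_real choose_three_real choose_four_real
    by (simp add: field_simps power2_eq_square)
qed

theorem theorem3p3:
  fixes n k :: nat
  assumes "k \<ge> 1" and "n \<ge> 2 * k - 1"
  shows
    "(n < (k + 1 choose 2) \<longrightarrow>
       (\<exists>r d. params_small n k r d) \<and>
       (\<forall>r d. params_small n k r d \<longrightarrow>
          real (max_inv n k) =
            real k ^ 2 + (real r ^ 2 - real r + 2 * real d - 2) * real k
            + 3 * real (r + 1 choose 4) - 2 * real (r + 1 choose 3)
            + (real d - 1) * real (r choose 2) - real d * real r
            + (real d ^ 2 - 5 * real d + 2) / 2
          \<and> card (maximizers n k) = (r choose d)))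
     \<and>
     (n \<ge> (k + 1 choose 2) \<longrightarrow>
       (\<exists>r d. params_large n k r d) \<and>
       (\<forall>r d. params_large n k r d \<longrightarrow>
          real (max_inv n k) =
            (3 * real k + 3 * real r + 2) / 4 * real (k + r + 1 choose 3)
            - (3 * real r - 2) / 4 * real (r + 1 choose 3)
            - real (k + r + 1 - d choose 3)
            - (real r * real k + real (k choose 2) + real d) * real (r + 1 choose 2)
            + (real k + real r) * real (d choose 2) - real (d choose 3)
          \<and> card (maximizers n k) = (k choose d)))"
proof (intro conjI impI allI)
  assume "n < (k + 1 choose 2)"
  then show "\<exists>r d. params_small n k r d" using params_small_exists assms by blast
next
  assume "(k + 1 choose 2) \<le> n"
  then show "\<exists>r d. params_large n k r d" using params_large_exists assms(1) by blast
qed (rule max_inv_small_real max_inv_small(2) max_inv_large_real[OF assms(1)]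
    max_inv_large(2)[OF assms(1)], assumption)+

end
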